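(* Let $F$ be an arbitrary field of characteristic $0$, let $F[x,y]$ be the polynomial algebra in two variables, put $f(x,y)=x^2+y^4-1$, $D=2y^3\frac{\partial}{\partial x}-x\frac{\partial}{\partial y}$ and $\Gamma=F[x,y]/f(x,y)F[x,y]$. Then the derivation $D$ of $F[x,y]$ induces a derivation of $\Gamma$, again denoted by $D$. Denote the images of $x,y$ in $\Gamma$ again by $x,y$. Let $A$ be the subalgebra of $\Gamma$ generated by $1$, $y^2$ and $xy$, let $M=xA+yA\subseteq\Gamma$, and put $\Delta=\{D_{11},D_{12},D_{22}\}$, where $D_{11}=(1-y^4)D$, $D_{12}=xyD$, $D_{22}=y^2D$. Then the subspace $J(A,\Delta)=A+\overline{M}$ of the Jordan superalgebra of vector type $J(\Gamma,D)=\Gamma+\overline{\Gamma}$ is a subsuperalgebra of $J(\Gamma,D)$, and the multiplication of odd elements in $J(A,\Delta)$ is given, for $a,b\in A$, by $$\overline{xa}\cdot\overline{xb}=D_{11}(a)b-aD_{11}(b),\qquad \overline{ya}\cdot\overline{yb}=D_{22}(a)b-aD_{22}(b),$$ $$\overline{xa}\cdot\overline{yb}=(1+y^4)ab+D_{12}(a)b-aD_{12}(b).$$ Moreover, $J(A,\Delta)$ is a simple superalgebra, and $\overline{M}$ is not a cyclic $A$-module; i.e., $J(A,\Delta)$ is not isomorphic to any superalgebra of vector type $J(\Gamma_0,D_0)$.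
   Context: A superalgebra over $F$ is a $\mathbb{Z}_2$-graded (not necessarily associative) $F$-algebra $J=J_0+J_1$, with $J_iJ_j\subseteq J_{i+j \bmod 2}$; $J_0$ is the even part and $J_1$ the odd part. It is simple if it has nonzero multiplication and no proper nonzero $\mathbb{Z}_2$-graded ideals. Isomorphisms are isomorphisms of superalgebras (grading-preserving). Superalgebra of vector type $J(\Gamma,D)$: let $\Gamma$ be a commutative associative $F$-algebra with a nonzero derivation $D$. Let $\overline{\Gamma}$ be an isomorphic copy of the linear space $\Gamma$ with a fixed isomorphism $a\mapsto\overline{a}$. On the direct sum $J(\Gamma,D)=\Gamma+\overline{\Gamma}$ of linear spaces the multiplication is $$a\cdot b=ab,\quad a\cdot\overline{b}=\overline{ab},\quad \overline{a}\cdot b=\overline{ab},\quad \overline{a}\cdot\overline{b}=D(a)b-aD(b)\qquad(a,b\in\Gamma),$$ where $ab$ is the product in $\Gamma$. The even part is $\Gamma$ and the odd part is $\overline{\Gamma}$; this is a Jordan superalgebra. For a subspace $M\subseteq\Gamma$, $\overline{M}=\{\overline{m}: m\in M\}$. The superalgebras $J(\Gamma_0,D_0)$ are those obtained by this construction from an arbitrary commutative associative $F$-algebra $\Gamma_0$ with a nonzero derivation $D_0$. The $A$-module structure on $\overline{M}$ is given by $a\cdot\overline{m}=\overline{am}$; an $A$-module is cyclic if it is generated by one element. *)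

theory Defs
  imports Complex_Main "HOL-Computational_Algebra.Polynomial" "HOL-Library.Product_Plus"
begin

definition comm_algebra :: "('f::field \<Rightarrow> 'g::comm_ring \<Rightarrow> 'g) \<Rightarrow> bool" where
  "comm_algebra s \<longleftrightarrow> vector_space s \<and> (\<forall>c a b. s c (a * b) = s c a * b)"

definition derivation :: "('f::field \<Rightarrow> 'g::comm_ring \<Rightarrow> 'g) \<Rightarrow> ('g \<Rightarrow> 'g) \<Rightarrow> bool" where
  "derivation s d \<longleftrightarrow> Vector_Spaces.linear s s d \<and> (\<forall>a b. d (a * b) = d a * b + a * d b)"

definition subalgebra :: "('f::field \<Rightarrow> 'g::comm_ring \<Rightarrow> 'g) \<Rightarrow> 'g set \<Rightarrow> bool" where
  "subalgebra s B \<longleftrightarrow> module.subspace s B \<and> (\<forall>a\<in>B. \<forall>b\<in>B. a * b \<in> B)"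

definition generated_subalgebra :: "('f::field \<Rightarrow> 'g::comm_ring \<Rightarrow> 'g) \<Rightarrow> 'g set \<Rightarrow> 'g set" where
  "generated_subalgebra s S = \<Inter>{B. subalgebra s B \<and> S \<subseteq> B}"

text \<open>
  The underlying space of a superalgebra is the subspace \<open>even S + odd S\<close> of an ambient
  vector space with scalar multiplication \<open>scl S\<close>; addition is that of the ambient type,
  and only the values of \<open>mul S\<close> on this subspace matter.
\<close>

record ('f, 'v) superalg =
  scl :: "'f \<Rightarrow> 'v \<Rightarrow> 'v"
  mul :: "'v \<Rightarrow> 'v \<Rightarrow> 'v"
  even_part :: "'v set"
  odd_part :: "'v set"

definition space_of :: "('f::field, 'v::ab_group_add) superalg \<Rightarrow> 'v set" where
  "space_of S = {u + v | u v. u \<in> even_part S \<and> v \<in> odd_part S}"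

definition superalgebra :: "('f::field, 'v::ab_group_add) superalg \<Rightarrow> bool" where
  "superalgebra S \<longleftrightarrow>
     vector_space (scl S) \<and>
     module.subspace (scl S) (even_part S) \<and>
     module.subspace (scl S) (odd_part S) \<and>
     even_part S \<inter> odd_part S = {0} \<and>
     (\<forall>u\<in>space_of S. \<forall>v\<in>space_of S. \<forall>w\<in>space_of S.
        mul S (u + v) w = mul S u w + mul S v w \<and>
        mul S w (u + v) = mul S w u + mul S w v) \<and>
     (\<forall>c. \<forall>u\<in>space_of S. \<forall>v\<in>space_of S.
        mul S (scl S c u) v = scl S c (mul S u v) \<and>
        mul S u (scl S c v) = scl S c (mul S u v)) \<and>
     (\<forall>u\<in>even_part S. \<forall>v\<in>even_part S. mul S u v \<in> even_part S) \<and>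
     (\<forall>u\<in>even_part S. \<forall>v\<in>odd_part S. mul S u v \<in> odd_part S) \<and>
     (\<forall>u\<in>odd_part S. \<forall>v\<in>even_part S. mul S u v \<in> odd_part S) \<and>
     (\<forall>u\<in>odd_part S. \<forall>v\<in>odd_part S. mul S u v \<in> even_part S)"

definition subsuperalgebra ::
    "('f::field, 'v::ab_group_add) superalg \<Rightarrow> ('f, 'v) superalg \<Rightarrow> bool" where
  "subsuperalgebra S T \<longleftrightarrow>
     superalgebra S \<and> superalgebra T \<and> scl S = scl T \<and> mul S = mul T \<and>
     even_part S \<subseteq> even_part T \<and> odd_part S \<subseteq> odd_part T"

definition graded_ideal :: "('f::field, 'v::ab_group_add) superalg \<Rightarrow> 'v set \<Rightarrow> bool" where
  "graded_ideal S I \<longleftrightarrow>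
     module.subspace (scl S) I \<and>
     I = {u + v | u v. u \<in> I \<inter> even_part S \<and> v \<in> I \<inter> odd_part S} \<and>
     (\<forall>u\<in>I. \<forall>w\<in>space_of S. mul S u w \<in> I \<and> mul S w u \<in> I)"

definition simple_superalgebra :: "('f::field, 'v::ab_group_add) superalg \<Rightarrow> bool" where
  "simple_superalgebra S \<longleftrightarrow>
     superalgebra S \<and>
     (\<exists>u\<in>space_of S. \<exists>v\<in>space_of S. mul S u v \<noteq> 0) \<and>
     (\<forall>I. graded_ideal S I \<longrightarrow> I = {0} \<or> I = space_of S)"

definition superalgebra_iso ::
    "('f::field, 'v::ab_group_add) superalg \<Rightarrow> ('f, 'w::ab_group_add) superalg \<Rightarrow> ('v \<Rightarrow> 'w) \<Rightarrow> bool"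
  where
  "superalgebra_iso S T h \<longleftrightarrow>
     bij_betw h (space_of S) (space_of T) \<and>
     (\<forall>u\<in>space_of S. \<forall>v\<in>space_of S. h (u + v) = h u + h v) \<and>
     (\<forall>c. \<forall>u\<in>space_of S. h (scl S c u) = scl T c (h u)) \<and>
     (\<forall>u\<in>space_of S. \<forall>v\<in>space_of S. h (mul S u v) = mul T (h u) (h v)) \<and>
     h ` even_part S = even_part T \<and> h ` odd_part S = odd_part T"

definition isomorphic_superalgebras ::
    "('f::field, 'v::ab_group_add) superalg \<Rightarrow> ('f, 'w::ab_group_add) superalg \<Rightarrow> bool" where
  "isomorphic_superalgebras S T \<longleftrightarrow> (\<exists>h. superalgebra_iso S T h)"

definition submodule_on :: "'a set \<Rightarrow> ('a \<Rightarrow> 'v::ab_group_add \<Rightarrow> 'v) \<Rightarrow> 'v set \<Rightarrow> bool" where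
  "submodule_on A act N \<longleftrightarrow>
     0 \<in> N \<and> (\<forall>u\<in>N. \<forall>v\<in>N. u + v \<in> N) \<and> (\<forall>u\<in>N. - u \<in> N) \<and> (\<forall>a\<in>A. \<forall>u\<in>N. act a u \<in> N)"

definition cyclic_module_on :: "'a set \<Rightarrow> ('a \<Rightarrow> 'v::ab_group_add \<Rightarrow> 'v) \<Rightarrow> 'v set \<Rightarrow> bool" where
  "cyclic_module_on A act M \<longleftrightarrow>
     submodule_on A act M \<and>
     (\<exists>m\<in>M. \<Inter>{N. submodule_on A act N \<and> m \<in> N} = M)"

text \<open>The pair \<open>(a, b)\<close> encodes the element \<open>a + \<close>bar\<open>(b)\<close> of the direct sum.\<close>

definition ev :: "'g::comm_ring \<Rightarrow> 'g \<times> 'g" where "ev a = (a, 0)"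

definition bar :: "'g::comm_ring \<Rightarrow> 'g \<times> 'g" where "bar a = (0, a)"

definition vector_mul :: "('g::comm_ring \<Rightarrow> 'g) \<Rightarrow> 'g \<times> 'g \<Rightarrow> 'g \<times> 'g \<Rightarrow> 'g \<times> 'g" where
  "vector_mul d u v =
     (fst u * fst v + (d (snd u) * snd v - snd u * d (snd v)),
      fst u * snd v + snd u * fst v)"

definition vector_superalg_on ::
    "('f::field \<Rightarrow> 'g::comm_ring \<Rightarrow> 'g) \<Rightarrow> ('g \<Rightarrow> 'g) \<Rightarrow> 'g set \<Rightarrow> 'g set \<Rightarrow> ('f, 'g \<times> 'g) superalg"
  where
  "vector_superalg_on s d A M =
     \<lparr>scl = (\<lambda>c u. (s c (fst u), s c (snd u))), mul = vector_mul d,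
      even_part = ev ` A, odd_part = bar ` M\<rparr>"

definition vector_superalg ::
    "('f::field \<Rightarrow> 'g::comm_ring \<Rightarrow> 'g) \<Rightarrow> ('g \<Rightarrow> 'g) \<Rightarrow> ('f, 'g \<times> 'g) superalg" where
  "vector_superalg s d = vector_superalg_on s d UNIV UNIV"

text \<open>
  \<open>F[x,y]\<close> is represented as \<open>F[x][y]\<close>: the variable \<open>x\<close> is the inner one, \<open>y\<close> the outer one.
\<close>

definition pX :: "'f::field_char_0 poly poly" where "pX = [:[:0, 1:]:]"

definition pY :: "'f::field_char_0 poly poly" where "pY = [:0, 1:]"

definition pscale :: "'f::field_char_0 \<Rightarrow> 'f poly poly \<Rightarrow> 'f poly poly" where
  "pscale c p = smult [:c:] p"

definition partial_x :: "'f::field_char_0 poly poly \<Rightarrow> 'f poly poly" where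
  "partial_x p = map_poly pderiv p"

definition partial_y :: "'f::field_char_0 poly poly \<Rightarrow> 'f poly poly" where
  "partial_y p = pderiv p"

definition pD :: "'f::field_char_0 poly poly \<Rightarrow> 'f poly poly" where
  "pD p = 2 * pY ^ 3 * partial_x p - pX * partial_y p"

definition curve_poly :: "'f::field_char_0 poly poly" where
  "curve_poly = pX ^ 2 + pY ^ 4 - 1"

definition curve_rel :: "'f::field_char_0 poly poly \<Rightarrow> 'f poly poly \<Rightarrow> bool" where
  "curve_rel p q \<longleftrightarrow> curve_poly dvd p - q"

lemma equivp_curve_rel: "equivp curve_rel"
proof (rule equivpI)
  show "reflp curve_rel"
    by (simp add: reflp_def curve_rel_def)
  show "symp curve_rel"
    unfolding symp_def curve_rel_def by (metis dvd_minus_iff minus_diff_eq)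
  show "transp curve_rel"
  proof (intro transpI)
    fix p q r
    assume "curve_rel p q" "curve_rel q r"
    then have "curve_poly dvd (p - q) + (q - r)"
      unfolding curve_rel_def by (rule dvd_add)
    then have "curve_poly dvd p - r" by simp
    then show "curve_rel p r" by (simp add: curve_rel_def)
  qed
qed

quotient_type (overloaded) 'f curve_ring = "'f::field_char_0 poly poly" / curve_rel
  morphisms rep_curve proj
  by (rule equivp_curve_rel)

instantiation curve_ring :: (field_char_0) comm_ring_1
begin

lift_definition zero_curve_ring :: "'a curve_ring" is 0 .

lift_definition one_curve_ring :: "'a curve_ring" is 1 .

lift_definition plus_curve_ring :: "'a curve_ring \<Rightarrow> 'a curve_ring \<Rightarrow> 'a curve_ring" is "(+)"
  unfolding curve_rel_def by (metis add_diff_add dvd_add)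

lift_definition uminus_curve_ring :: "'a curve_ring \<Rightarrow> 'a curve_ring" is uminus
  unfolding curve_rel_def by (metis dvd_minus_iff minus_diff_minus)

lift_definition minus_curve_ring :: "'a curve_ring \<Rightarrow> 'a curve_ring \<Rightarrow> 'a curve_ring" is "(-)"
proof -
  fix p q r s :: "'a poly poly"
  assume "curve_rel p q" "curve_rel r s"
  then have "curve_poly dvd (p - q) - (r - s)"
    unfolding curve_rel_def by (rule dvd_diff)
  then show "curve_rel (p - r) (q - s)"
    by (simp add: curve_rel_def algebra_simps)
qed

lift_definition times_curve_ring :: "'a curve_ring \<Rightarrow> 'a curve_ring \<Rightarrow> 'a curve_ring" is "(*)"
proof -
  fix p q r s :: "'a poly poly"
  assume "curve_rel p q" "curve_rel r s"
  then have "curve_poly dvd (p - q) * r + q * (r - s)"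
    unfolding curve_rel_def by (intro dvd_add dvd_mult dvd_mult2)
  then show "curve_rel (p * r) (q * s)"
    by (simp add: curve_rel_def algebra_simps)
qed

instance
proof
  show "(0::'a curve_ring) \<noteq> 1"
  proof transfer
    show "\<not> curve_rel (0::'a poly poly) 1"
    proof
      assume "curve_rel (0::'a poly poly) 1"
      then have "(curve_poly :: 'a poly poly) dvd 1"
        by (simp add: curve_rel_def)
      then obtain q where q: "(1 :: 'a poly poly) = curve_poly * q" by (elim dvdE)
      have "poly (poly (1 :: 'a poly poly) 0) 1 = poly (poly (curve_poly * q) 0) 1"
        using q by simp
      then show False by (simp add: curve_poly_def pX_def pY_def)
    qed
  qed
qed (transfer; simp add: curve_rel_def algebra_simps)+

end

definition gscale :: "'f::field_char_0 \<Rightarrow> 'f curve_ring \<Rightarrow> 'f curve_ring" where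
  "gscale c z = proj [:[:c:]:] * z"

definition gX :: "'f::field_char_0 curve_ring" where "gX = proj pX"

definition gY :: "'f::field_char_0 curve_ring" where "gY = proj pY"

text \<open>
  The induced map is computed on a chosen representative; that the choice is irrelevant,
  \<open>gD (proj p) = proj (pD p)\<close>, is not built into the definition.
\<close>

definition gD :: "'f::field_char_0 curve_ring \<Rightarrow> 'f curve_ring" where
  "gD z = proj (pD (rep_curve z))"

definition algA :: "'f::field_char_0 curve_ring set" where
  "algA = generated_subalgebra gscale {1, gY ^ 2, gX * gY}"

definition modM :: "'f::field_char_0 curve_ring set" where
  "modM = {gX * a + gY * b | a b. a \<in> algA \<and> b \<in> algA}"

definition D11 :: "'f::field_char_0 curve_ring \<Rightarrow> 'f curve_ring" where
  "D11 a = (1 - gY ^ 4) * gD a"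

definition D12 :: "'f::field_char_0 curve_ring \<Rightarrow> 'f curve_ring" where
  "D12 a = gX * gY * gD a"

definition D22 :: "'f::field_char_0 curve_ring \<Rightarrow> 'f curve_ring" where
  "D22 a = gY ^ 2 * gD a"

definition JA :: "('f::field_char_0, 'f curve_ring \<times> 'f curve_ring) superalg" where
  "JA = vector_superalg_on gscale gD algA modM"

end

theory Submission
  imports Defs
begin

text \<open>
  Put \<open>t = y\<^sup>2\<close> and \<open>s = xy\<close>. In \<open>\<Gamma>\<close> these satisfy \<open>s\<^sup>2 = t - t\<^sup>3\<close>, so
  \<open>A = F[t] + s F[t]\<close> is the coordinate ring of an affine elliptic curve, and
  \<open>M = y F[t] + x F[t]\<close> is a module over it. They are the even and the odd part of \<open>\<Gamma>\<close>
  for the automorphism \<open>(x, y) \<mapsto> (-x, -y)\<close>, with which \<open>D\<close> commutes. Hence \<open>D\<close> preserves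
  \<open>A\<close> and \<open>M\<close>, and \<open>M M \<subseteq> A\<close>; this gives the subsuperalgebra, and the product
  formulas are the Leibniz rule with \<open>D(x) = 2y\<^sup>3\<close>, \<open>D(y) = -x\<close> and \<open>x\<^sup>2 = 1 - y\<^sup>4\<close>.

  Simplicity follows from three properties of \<open>(A, M, D)\<close>: the products of elements of \<open>M\<close>
  span \<open>1 = x x + y (y\<^sup>2 y)\<close>, the ideal of \<open>A\<close> generated by \<open>D(A)\<close> is \<open>A\<close>, and no proper
  nonzero ideal of \<open>A\<close> is stable under \<open>D\<close>. The passage from these to simplicity is \<open>simple_J\<close>.
  For the third property (\<open>algA_gD_simple\<close>), multiply a nonzero element of the ideal by its
  conjugate under \<open>s \<mapsto> -s\<close> to reach a nonzero polynomial in \<open>t\<close>. Applying \<open>D\<close>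
  differentiates this polynomial at the cost of factors \<open>s\<close>, so a power of \<open>s\<close> lies in the ideal;
  applying \<open>D\<close> further lowers this power to \<open>1\<close>, because \<open>s\<close> and \<open>D(s) = 3t\<^sup>2 - 1\<close> have no
  common zero.

  A superalgebra \<open>J(\<Gamma>\<^sub>0, D\<^sub>0)\<close> whose even part has a unit has a cyclic odd part
  (\<open>iso_imp_cyclic_odd\<close>), so it remains to see that \<open>M\<close> is not cyclic (\<open>modM_not_cyclic\<close>). The norm
  \<open>t p\<^sup>2 - (1 - t\<^sup>2) q\<^sup>2\<close> of a generator \<open>y p(t) + x q(t)\<close> would divide the norms \<open>t\<close> of \<open>y\<close>
  and \<open>t\<^sup>2 - 1\<close> of \<open>x\<close>. The two terms of the norm have degrees of opposite parity and cannot
  cancel, which leaves no room for such a divisor.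
\<close>

section \<open>Superalgebras of vector type on a pair of subspaces\<close>

lemma derivation_simps:
  assumes "derivation s d"
  shows "d (a + b) = d a + d b" "d (s c a) = s c (d a)" "d (a * b) = d a * b + a * d b"
    "d 0 = 0" "d (- a) = - d a" "d (a - b) = d a - d b"
proof -
  interpret Vector_Spaces.linear s s d
    using assms by (simp add: derivation_def)
  show "d (a + b) = d a + d b" "d (s c a) = s c (d a)"
    "d 0 = 0" "d (- a) = - d a" "d (a - b) = d a - d b"
    by (rule add scale zero neg diff)+
  show "d (a * b) = d a * b + a * d b"
    using assms by (simp add: derivation_def)
qed

lemma vector_mul_ev_bar:
  assumes "derivation s d"
  shows "vector_mul d (ev a) (ev b) = ev (a * b)"
    "vector_mul d (ev a) (bar m) = bar (a * m)"
    "vector_mul d (bar m) (ev a) = bar (a * m)"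
    "vector_mul d (bar m) (bar n) = ev (d m * n - m * d n)"
  by (simp_all add: vector_mul_def ev_def bar_def derivation_simps[OF assms] mult.commute)

lemma ev_bar_arith:
  "ev a + ev b = ev (a + b)" "bar m + bar n = bar (m + n)" "ev 0 = 0" "bar 0 = 0"
  "ev a + bar m = (a, m)" "- bar m = bar (- m)" "ev a = ev b \<longleftrightarrow> a = b" "bar m = bar n \<longleftrightarrow> m = n"
  by (simp_all add: ev_def bar_def zero_prod_def)

locale vector_type_pair =
  fixes s :: "'f::field \<Rightarrow> 'g::comm_ring_1 \<Rightarrow> 'g" and d :: "'g \<Rightarrow> 'g" and A M :: "'g set"
  assumes alg: "comm_algebra s"
    and der: "derivation s d"
    and subalgebra_A: "subalgebra s A"
    and one_A: "1 \<in> A"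
    and subspace_M: "module.subspace s M"
    and act_M: "\<And>a m. a \<in> A \<Longrightarrow> m \<in> M \<Longrightarrow> a * m \<in> M"
    and wronskian: "\<And>m n. m \<in> M \<Longrightarrow> n \<in> M \<Longrightarrow> d m * n - m * d n \<in> A"
begin

sublocale vs: vector_space s
  using alg by (simp add: comm_algebra_def)

lemma scale_mult: "s c a * b = s c (a * b)" "b * s c a = s c (b * a)"
proof -
  show left: "s c a * b = s c (a * b)" for a b
    using alg by (simp add: comm_algebra_def)
  show "b * s c a = s c (b * a)"
    using left[of a b] by (simp add: mult.commute)
qed

lemmas d_simps = derivation_simps[OF der]
lemmas mul_simps = vector_mul_ev_bar[OF der]

abbreviation J where "J \<equiv> vector_superalg_on s d A M"

lemma J_simps:
  "scl J = (\<lambda>c u. (s c (fst u), s c (snd u)))" "mul J = vector_mul d"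
  "even_part J = ev ` A" "odd_part J = bar ` M"
  by (simp_all add: vector_superalg_on_def)

lemma space_of_J: "space_of J = A \<times> M"
proof -
  have "space_of J = {ev a + bar m | a m. a \<in> A \<and> m \<in> M}"
    unfolding space_of_def J_simps by blast
  then show ?thesis by (auto simp: ev_bar_arith)
qed

lemma subspace_A: "vs.subspace A" and mult_A: "a \<in> A \<Longrightarrow> b \<in> A \<Longrightarrow> a * b \<in> A"
  using subalgebra_A by (auto simp: subalgebra_def)

lemma vector_space_J: "vector_space (scl J)"
  by unfold_locales
    (auto simp: J_simps vs.scale_right_distrib vs.scale_left_distrib plus_prod_def)

sublocale js: vector_space "scl J"
  by (rule vector_space_J)

lemma scl_ev_bar: "scl J c (ev a) = ev (s c a)" "scl J c (bar m) = bar (s c m)"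
  by (simp_all add: J_simps ev_def bar_def)

lemma superalgebra_J: "superalgebra J"
  unfolding superalgebra_def
proof (intro conjI)
  show "vector_space (scl J)" by (rule vector_space_J)
  show "js.subspace (even_part J)"
    using subspace_A unfolding js.subspace_def vs.subspace_def
    by (auto simp: J_simps(3) scl_ev_bar ev_bar_arith intro!: image_eqI[where f = ev])
  show "js.subspace (odd_part J)"
    using subspace_M unfolding js.subspace_def vs.subspace_def
    by (auto simp: J_simps(4) scl_ev_bar ev_bar_arith intro!: image_eqI[where f = bar])
  show "even_part J \<inter> odd_part J = {0}"
    using vs.subspace_0[OF subspace_A] vs.subspace_0[OF subspace_M]
    by (auto simp: J_simps ev_def bar_def zero_prod_def)
  show "\<forall>u\<in>space_of J. \<forall>v\<in>space_of J. \<forall>w\<in>space_of J.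
        mul J (u + v) w = mul J u w + mul J v w \<and> mul J w (u + v) = mul J w u + mul J w v"
    by (simp add: J_simps vector_mul_def d_simps algebra_simps)
  show "\<forall>c. \<forall>u\<in>space_of J. \<forall>v\<in>space_of J.
        mul J (scl J c u) v = scl J c (mul J u v) \<and> mul J u (scl J c v) = scl J c (mul J u v)"
    by (simp add: J_simps vector_mul_def d_simps scale_mult vs.scale_right_distrib
        vs.scale_right_diff_distrib)
qed (auto simp: J_simps mul_simps mult_A act_M wronskian)

lemma submodule_on_odd: "submodule_on A (\<lambda>a. mul J (ev a)) (bar ` M)"
  using subspace_M vs.subspace_neg[OF subspace_M]
  unfolding submodule_on_def vs.subspace_def
  by (auto simp: J_simps mul_simps ev_bar_arith act_M intro!: image_eqI[where f = bar])

text \<open>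
  Cyclicity is defined by an intersection of submodules; as \<open>A\<close> is a ring with \<open>1\<close>, the
  multiples of an element already form the smallest submodule that contains it.
\<close>

lemma cyclic_odd_iff:
  "cyclic_module_on A (\<lambda>a. mul J (ev a)) (bar ` M) \<longleftrightarrow> (\<exists>m\<in>M. M \<subseteq> {a * m | a. a \<in> A})"
proof
  assume "cyclic_module_on A (\<lambda>a. mul J (ev a)) (bar ` M)"
  then obtain m where m: "m \<in> M"
    and gen: "\<Inter>{N. submodule_on A (\<lambda>a. mul J (ev a)) N \<and> bar m \<in> N} = bar ` M"
    by (auto simp: cyclic_module_on_def)
  let ?N = "{bar (a * m) | a. a \<in> A}"
  have closed: "x + y \<in> ?N" "- x \<in> ?N" "mul J (ev a) x \<in> ?N"
    if xy: "x \<in> ?N" "y \<in> ?N" and "a \<in> A" for x y a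
  proof -
    obtain b c where bc: "b \<in> A" "c \<in> A" "x = bar (b * m)" "y = bar (c * m)"
      using xy by blast
    have "x + y = bar ((b + c) * m)" "- x = bar ((- b) * m)" "mul J (ev a) x = bar ((a * b) * m)"
      by (simp_all add: bc J_simps mul_simps ev_bar_arith algebra_simps)
    then show "x + y \<in> ?N" "- x \<in> ?N" "mul J (ev a) x \<in> ?N"
      using bc(1,2) \<open>a \<in> A\<close> vs.subspace_add[OF subspace_A, of b c]
        vs.subspace_neg[OF subspace_A, of b] mult_A[of a b]
      by blast+
  qed
  have "0 \<in> ?N"
    using vs.subspace_0[OF subspace_A] by (force simp: ev_bar_arith)
  with closed have "submodule_on A (\<lambda>a. mul J (ev a)) ?N"
    unfolding submodule_on_def using one_A by (intro conjI ballI) simp_all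
  moreover have "bar m \<in> ?N"
    using one_A by force
  ultimately have "bar ` M \<subseteq> ?N"
    using gen by blast
  then show "\<exists>m\<in>M. M \<subseteq> {a * m | a. a \<in> A}"
    using m by (fastforce simp: ev_bar_arith)
next
  assume "\<exists>m\<in>M. M \<subseteq> {a * m | a. a \<in> A}"
  then obtain m where m: "m \<in> M" and gen: "M \<subseteq> {a * m | a. a \<in> A}"
    by blast
  have "bar ` M \<subseteq> N" if N: "submodule_on A (\<lambda>a. mul J (ev a)) N" "bar m \<in> N" for N
  proof
    fix x assume "x \<in> bar ` M"
    then obtain a where "a \<in> A" "x = mul J (ev a) (bar m)"
      using gen by (fastforce simp: J_simps mul_simps)
    then show "x \<in> N"
      using N by (simp add: submodule_on_def)
  qed
  then show "cyclic_module_on A (\<lambda>a. mul J (ev a)) (bar ` M)"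
    using submodule_on_odd m unfolding cyclic_module_on_def by blast
qed

text \<open>
  The algebra \<open>\<Gamma>\<^sub>0\<close> may lack a unit a priori, but an isomorphism carries \<open>1 \<in> A\<close> to a unit
  \<open>e\<close> of it. Then \<open>bar z = z bar e\<close> for every \<open>z\<close>, and the preimage of \<open>bar e\<close> generates the odd
  part of \<open>J\<close>.
\<close>

lemma iso_imp_cyclic_odd:
  fixes s0 :: "'f \<Rightarrow> 'h::comm_ring \<Rightarrow> 'h"
  assumes der0: "derivation s0 D0"
    and iso: "isomorphic_superalgebras J (vector_superalg s0 D0)"
  shows "cyclic_module_on A (\<lambda>a. mul J (ev a)) (bar ` M)"
proof -
  let ?T = "vector_superalg s0 D0"
  note mul0 = vector_mul_ev_bar[OF der0]
  have T: "mul ?T = vector_mul D0" "even_part ?T = range ev" "odd_part ?T = range bar"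
    by (simp_all add: vector_superalg_def vector_superalg_on_def)
  obtain h where h: "superalgebra_iso J ?T h"
    using iso by (auto simp: isomorphic_superalgebras_def)
  have inj: "inj_on h (A \<times> M)"
    using h by (simp add: superalgebra_iso_def space_of_J bij_betw_def)
  have hmul: "h (vector_mul d u v) = vector_mul D0 (h u) (h v)" if "u \<in> A \<times> M" "v \<in> A \<times> M" for u v
    using h that unfolding superalgebra_iso_def space_of_J T J_simps by blast
  have hev: "h ` ev ` A = range ev" and hbar: "h ` bar ` M = range bar"
    using h by (simp_all add: superalgebra_iso_def T J_simps)
  have mem: "ev a \<in> A \<times> M" "bar m \<in> A \<times> M" if "a \<in> A" "m \<in> M" for a m
    using that vs.subspace_0[OF subspace_A] vs.subspace_0[OF subspace_M]
    by (simp_all add: ev_def bar_def)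
  obtain e where e: "h (ev 1) = ev e"
    using hev one_A by blast
  have "bar e \<in> h ` bar ` M"
    unfolding hbar by (rule rangeI)
  then obtain m where m: "m \<in> M" "h (bar m) = bar e"
    by force
  have "\<exists>a\<in>A. n = a * m" if n: "n \<in> M" for n
  proof -
    obtain z where z: "h (bar n) = bar z"
      using hbar n by blast
    have "ev z \<in> h ` ev ` A"
      unfolding hev by (rule rangeI)
    then obtain a where a: "a \<in> A" "h (ev a) = ev z"
      by force
    have "h (vector_mul d (ev 1) (ev a)) = vector_mul D0 (ev e) (ev z)"
      using a mem[OF one_A m(1)] mem[OF a(1) m(1)] e by (simp add: hmul)
    then have "z * e = z"
      using a by (simp add: mul_simps mul0 ev_bar_arith mult.commute)
    then have "h (bar n) = h (vector_mul d (ev a) (bar m))"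
      using a m z mem[OF a(1) m(1)] by (simp add: hmul mul0)
    then have "bar n = vector_mul d (ev a) (bar m)"
      using inj_onD[OF inj] mem[OF a(1) n] mem[OF a(1) act_M[OF a(1) m(1)]]
      by (simp add: mul_simps)
    then show ?thesis
      using a by (auto simp: mul_simps ev_bar_arith)
  qed
  then show ?thesis
    unfolding cyclic_odd_iff using m by blast
qed

text \<open>
  Let \<open>I0 + bar I1\<close> be a graded ideal. Failure of the odd product to be \<open>A\<close>-bilinear is measured
  by \<open>D\<close>: comparing \<open>bar(am) bar(n)\<close> with \<open>a (bar(m) bar(n))\<close> leaves the term \<open>D(a) m n\<close>. For \<open>a \<in> I0\<close> this gives \<open>D(a) M M \<subseteq> I0\<close>, so \<open>I0\<close> is stable under
  \<open>D\<close>; for \<open>u \<in> I1\<close> it gives \<open>u M D(A) \<subseteq> I0\<close>, so \<open>u M \<subseteq> I0\<close>. Thus either \<open>I0\<close> is zero, and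
  then \<open>u M M = 0\<close> forces \<open>I1\<close> to be zero, or \<open>I0\<close> contains \<open>1\<close> by the assumption on stable ideals.
\<close>

theorem simple_J:
  assumes one_MM: "1 \<in> vs.span {m * n | m n. m \<in> M \<and> n \<in> M}"
    and one_AdA: "1 \<in> vs.span {a * d b | a b. a \<in> A \<and> b \<in> A}"
    and d_simple: "\<And>I. vs.subspace I \<Longrightarrow> I \<subseteq> A \<Longrightarrow> (\<And>a b. a \<in> A \<Longrightarrow> b \<in> I \<Longrightarrow> a * b \<in> I)
      \<Longrightarrow> (\<And>b. b \<in> I \<Longrightarrow> d b \<in> I) \<Longrightarrow> I \<noteq> {0} \<Longrightarrow> 1 \<in> I"
    and d_A: "\<And>a. a \<in> A \<Longrightarrow> d a \<in> A"
  shows "simple_superalgebra J"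
  unfolding simple_superalgebra_def
proof (intro conjI allI impI)
  show "superalgebra J" by (rule superalgebra_J)
  have "ev 1 \<in> space_of J"
    using one_A vs.subspace_0[OF subspace_M] by (simp add: space_of_J ev_def)
  moreover have "mul J (ev 1) (ev 1) \<noteq> 0"
    by (simp add: J_simps mul_simps) (simp add: ev_def zero_prod_def)
  ultimately show "\<exists>u\<in>space_of J. \<exists>v\<in>space_of J. mul J u v \<noteq> 0" by blast
next
  fix I assume I: "graded_ideal J I"
  have I_subspace: "js.subspace I"
    using I by (simp add: graded_ideal_def)
  have I_mult: "vector_mul d u w \<in> I" if "u \<in> I" "w \<in> A \<times> M" for u w
    using I that unfolding graded_ideal_def space_of_J J_simps by blast
  have I_split: "I = {u + v | u v. u \<in> I \<inter> ev ` A \<and> v \<in> I \<inter> bar ` M}"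
    using I by (simp add: graded_ideal_def J_simps)
  have mem: "ev a \<in> A \<times> M" "bar m \<in> A \<times> M" if "a \<in> A" "m \<in> M" for a m
    using that vs.subspace_0[OF subspace_A] vs.subspace_0[OF subspace_M]
    by (simp_all add: ev_def bar_def)
  have zero_A: "0 \<in> A" and zero_M: "0 \<in> M"
    using vs.subspace_0[OF subspace_A] vs.subspace_0[OF subspace_M] .
  define I0 where "I0 = {a \<in> A. ev a \<in> I}"
  define I1 where "I1 = {m \<in> M. bar m \<in> I}"
  have I_parts: "\<exists>a\<in>I0. \<exists>m\<in>I1. x = ev a + bar m" if "x \<in> I" for x
  proof -
    have "x \<in> {u + v | u v. u \<in> I \<inter> ev ` A \<and> v \<in> I \<inter> bar ` M}"
      using equalityD1[OF I_split] that by (rule subsetD)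
    then show ?thesis
      unfolding I0_def I1_def by blast
  qed
  have I0_subspace: "vs.subspace I0"
    unfolding vs.subspace_def I0_def
    using js.subspace_0[OF I_subspace] js.subspace_add[OF I_subspace]
      js.subspace_scale[OF I_subspace] vs.subspace_add[OF subspace_A]
      vs.subspace_scale[OF subspace_A] zero_A
    by (auto simp flip: ev_bar_arith(1) scl_ev_bar(1) simp: ev_bar_arith(3))
  have I0_A: "a * b \<in> I0" if "a \<in> A" "b \<in> I0" for a b
    using I_mult[of "ev b" "ev a"] that mem[OF _ zero_M] mult_A
    by (auto simp: I0_def mul_simps mult.commute)
  have I0_M: "a * m \<in> I1" if "a \<in> I0" "m \<in> M" for a m
    using I_mult[of "ev a" "bar m"] that mem[OF zero_A] act_M
    by (auto simp: I0_def I1_def mul_simps)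
  have I1_A: "a * u \<in> I1" if "a \<in> A" "u \<in> I1" for a u
    using I_mult[of "bar u" "ev a"] that mem[OF _ zero_M] act_M
    by (auto simp: I1_def mul_simps)
  have I1_M: "d u * m - u * d m \<in> I0" if "u \<in> I1" "m \<in> M" for u m
    using I_mult[of "bar u" "bar m"] that mem[OF zero_A] wronskian
    by (auto simp: I0_def I1_def mul_simps)
  have quotient_subspace: "vs.subspace {v. c * v \<in> L}" if "vs.subspace L" for c L
    using that by (auto simp: vs.subspace_def distrib_left scale_mult)
  have I0_d: "d a \<in> I0" if a: "a \<in> I0" for a
  proof -
    have "d a * (m * n) \<in> I0" if mn: "m \<in> M" "n \<in> M" for m n
    proof -
      have "d a * (m * n) = (d (a * m) * n - a * m * d n) - (d m * n - m * d n) * a"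
        by (simp add: d_simps algebra_simps)
      also have "\<dots> \<in> I0"
        using I0_A[OF wronskian[OF mn] a]
        by (intro vs.subspace_diff[OF I0_subspace] I1_M I0_M a mn) (simp add: mult.commute)
      finally show ?thesis .
    qed
    then have "vs.span {m * n | m n. m \<in> M \<and> n \<in> M} \<subseteq> {v. d a * v \<in> I0}"
      by (intro vs.span_minimal quotient_subspace I0_subspace) auto
    then show ?thesis using one_MM by auto
  qed
  have I1_M_I0: "u * m \<in> I0" if u: "u \<in> I1" and m: "m \<in> M" for u m
  proof -
    have "u * m * (a * d b) \<in> I0" if ab: "a \<in> A" "b \<in> A" for a b
    proof -
      have "u * m * (a * d b)
          = b * (d u * (a * m) - u * d (a * m)) - (d u * (b * (a * m)) - u * d (b * (a * m)))"
        by (simp add: d_simps algebra_simps)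
      also have "\<dots> \<in> I0"
        using ab u m by (intro vs.subspace_diff[OF I0_subspace] I0_A I1_M act_M)
      finally show ?thesis .
    qed
    then have "vs.span {a * d b | a b. a \<in> A \<and> b \<in> A} \<subseteq> {v. u * m * v \<in> I0}"
      by (intro vs.span_minimal quotient_subspace I0_subspace) auto
    then show ?thesis using one_AdA by auto
  qed
  show "I = {0} \<or> I = space_of J"
  proof (cases "I0 = {0}")
    case True
    have "u = 0" if u: "u \<in> I1" for u
    proof -
      have "u * (m * n) = 0" if "m \<in> M" "n \<in> M" for m n
        using I1_M_I0[OF u \<open>m \<in> M\<close>] True by (simp flip: mult.assoc)
      then have "vs.span {m * n | m n. m \<in> M \<and> n \<in> M} \<subseteq> {v. u * v \<in> {0}}"
        by (intro vs.span_minimal quotient_subspace vs.subspace_single_0) auto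
      then show ?thesis using one_MM by auto
    qed
    then have "I1 \<subseteq> {0}" by blast
    then have "I \<subseteq> {0}"
      using I_parts True by (fastforce simp: ev_bar_arith(3,4) simp del: split_paired_All)
    then show ?thesis
      using js.subspace_0[OF I_subspace] by blast
  next
    case False
    have "1 \<in> I0"
      using False by (intro d_simple I0_subspace I0_A I0_d) (auto simp: I0_def)
    then have "A \<subseteq> I0" "M \<subseteq> I1"
      using I0_A[of _ 1] I0_M[of 1] by auto
    then have "ev a + bar m \<in> I" if "a \<in> A" "m \<in> M" for a m
      using that by (intro js.subspace_add[OF I_subspace]) (auto simp: I0_def I1_def)
    then have "A \<times> M \<subseteq> I"
      by (auto simp: ev_bar_arith(5))
    moreover have "I \<subseteq> A \<times> M"
      using I_parts by (fastforce simp: ev_bar_arith(5) I0_def I1_def simp del: split_paired_All)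
    ultimately show ?thesis
      by (simp add: space_of_J)
  qed
qed

end


section \<open>Squares weighted by polynomials of opposite degree parity\<close>

text \<open>
  The degrees of \<open>v p\<^sup>2\<close> and \<open>w q\<^sup>2\<close> have opposite parity, so their leading terms cannot cancel.
  The norms from \<open>A\<close> and from \<open>M\<close> to \<open>F[t]\<close> are differences of this kind.
\<close>

lemma degree_diff_weighted_squares:
  fixes p q v w :: "'a::idom poly"
  assumes "v \<noteq> 0" "w \<noteq> 0" "odd (degree v + degree w)"
  shows "degree (v * p\<^sup>2 - w * q\<^sup>2) = max (degree (v * p\<^sup>2)) (degree (w * q\<^sup>2))"
    and "v * p\<^sup>2 = w * q\<^sup>2 \<longleftrightarrow> p = 0 \<and> q = 0"
proof -
  have deg: "degree (u * r\<^sup>2) = degree u + 2 * degree r" if "u \<noteq> 0" "r \<noteq> 0" for u r :: "'a poly"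
    using that by (simp add: degree_mult_eq degree_power_eq)
  have neq: "degree (v * p\<^sup>2) \<noteq> degree (w * q\<^sup>2)" if "p \<noteq> 0" "q \<noteq> 0"
  proof
    assume "degree (v * p\<^sup>2) = degree (w * q\<^sup>2)"
    then have "degree v + 2 * degree p = degree w + 2 * degree q"
      using assms that by (simp add: deg)
    then show False
      using assms(3) by presburger
  qed
  show "degree (v * p\<^sup>2 - w * q\<^sup>2) = max (degree (v * p\<^sup>2)) (degree (w * q\<^sup>2))"
  proof (cases "p = 0 \<or> q = 0")
    case False
    then have "degree (v * p\<^sup>2) \<noteq> degree (w * q\<^sup>2)"
      using neq by blast
    then consider "degree (w * q\<^sup>2) < degree (v * p\<^sup>2)" | "degree (v * p\<^sup>2) < degree (w * q\<^sup>2)"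
      by linarith
    then show ?thesis
    proof cases
      case 1
      then show ?thesis
        unfolding diff_conv_add_uminus by (subst degree_add_eq_left) simp_all
    next
      case 2
      then show ?thesis
        unfolding diff_conv_add_uminus by (subst degree_add_eq_right) simp_all
    qed
  qed auto
  show "v * p\<^sup>2 = w * q\<^sup>2 \<longleftrightarrow> p = 0 \<and> q = 0"
    using neq assms by (cases "p = 0"; cases "q = 0") auto
qed

section \<open>The coordinate ring of the curve and its derivation\<close>

lemma partial_x_pCons: "partial_x (pCons a p) = pCons (pderiv a) (partial_x p)"
  by (simp add: partial_x_def map_poly_pCons)

lemma partial_x_0 [simp]: "partial_x 0 = 0"
  by (simp add: partial_x_def)

lemma partial_x_1 [simp]: "partial_x 1 = 0"
  by (simp add: one_pCons partial_x_pCons)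

lemma partial_x_add: "partial_x (p + q) = partial_x p + partial_x q"
  by (rule poly_eqI) (simp add: partial_x_def coeff_map_poly pderiv_add)

lemma partial_x_smult: "partial_x (smult a q) = smult (pderiv a) q + smult a (partial_x q)"
  by (rule poly_eqI) (simp add: partial_x_def coeff_map_poly pderiv_mult mult.commute)

lemma partial_x_mult: "partial_x (p * q) = partial_x p * q + p * partial_x q"
  by (induction p) (simp_all add: partial_x_pCons partial_x_add partial_x_smult algebra_simps)

lemma vector_space_pscale: "vector_space pscale"
  by unfold_locales
    (auto simp: pscale_def smult_add_right smult_add_left mult.commute
      simp flip: smult_add_left one_pCons)

lemma derivation_pD: "derivation pscale (pD :: 'f::field_char_0 poly poly \<Rightarrow> 'f poly poly)"
  unfolding derivation_def Vector_Spaces.linear_iff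
proof (intro conjI allI vector_space_pscale)
  fix p q :: "'f poly poly" and c :: 'f
  show "pD (p + q) = pD p + pD q"
    by (simp add: pD_def partial_y_def partial_x_add pderiv_add algebra_simps)
  show "pD (pscale c p) = pscale c (pD p)"
    by (simp add: pD_def pscale_def partial_y_def partial_x_smult pderiv_smult smult_diff_right
        pderiv_pCons flip: one_pCons)
  show "pD (p * q) = pD p * q + p * pD q"
    by (simp add: pD_def partial_y_def partial_x_mult pderiv_mult algebra_simps)
qed

lemma pD_pX: "pD pX = 2 * pY ^ 3"
  by (simp add: pD_def pX_def partial_x_pCons partial_y_def pderiv_pCons flip: one_pCons)

lemma pD_pY: "pD pY = - pX"
  by (simp add: pD_def pY_def partial_x_pCons partial_y_def pderiv_pCons flip: one_pCons)

lemma pD_1: "pD 1 = 0"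
  by (simp add: pD_def one_pCons partial_x_pCons partial_y_def pderiv_pCons)

text \<open>
  \<open>D\<close> is the Hamiltonian vector field of the curve equation up to scaling, so it kills that
  equation; this is what lets it descend to the quotient.
\<close>

lemma pD_curve_poly: "pD curve_poly = 0"
proof -
  note d = derivation_simps[OF derivation_pD]
  show ?thesis
    by (simp add: curve_poly_def power2_eq_square power4_eq_xxxx d pD_pX pD_pY pD_1)
      (simp add: algebra_simps power3_eq_cube)
qed

lemma proj_eq_iff: "proj p = proj q \<longleftrightarrow> curve_poly dvd p - q"
  by (simp add: curve_ring.abs_eq_iff curve_rel_def)

lemma proj_rep [simp]: "proj (rep_curve z) = z"
  by (rule Quotient3_abs_rep[OF Quotient3_curve_ring])

lemma proj_arith:
  "proj (p + q) = proj p + proj q" "proj (p - q) = proj p - proj q" "proj (p * q) = proj p * proj q"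
  "proj 0 = 0" "proj 1 = 1" "proj (- p) = - proj p"
  by (simp_all add: plus_curve_ring.abs_eq minus_curve_ring.abs_eq times_curve_ring.abs_eq
      zero_curve_ring_def one_curve_ring_def uminus_curve_ring.abs_eq)

lemma proj_power: "proj (p ^ n) = proj p ^ n"
  by (induction n) (simp_all add: proj_arith)

lemma proj_pscale: "proj (pscale c p) = gscale c (proj p)"
  by (simp add: pscale_def gscale_def flip: proj_arith)

lemma curve_ring_cases: obtains p where "z = proj p"
  by (metis proj_rep)

lemma gD_proj: "gD (proj p) = proj (pD p)"
proof -
  note d = derivation_simps[OF derivation_pD]
  obtain q where q: "rep_curve (proj p) - p = curve_poly * q"
    using proj_eq_iff[of "rep_curve (proj p)" p] by (auto elim: dvdE)
  have "pD (rep_curve (proj p)) - pD p = curve_poly * pD q"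
    unfolding d(6)[symmetric] q by (simp add: d pD_curve_poly)
  then show ?thesis
    by (simp add: gD_def proj_eq_iff)
qed

lemma vector_space_gscale: "vector_space (gscale :: 'f::field_char_0 \<Rightarrow> _)"
proof -
  interpret p: vector_space "pscale :: 'f \<Rightarrow> _" by (rule vector_space_pscale)
  have "gscale a (u + v) = gscale a u + gscale a v \<and> gscale (a + b) u = gscale a u + gscale b u
      \<and> gscale a (gscale b u) = gscale (a * b) u \<and> gscale 1 u = u" for a b :: 'f and u v
    by (cases u rule: curve_ring_cases; cases v rule: curve_ring_cases)
      (simp add: p.scale_right_distrib p.scale_left_distrib
        flip: proj_arith(1) proj_pscale)
  then show ?thesis
    by (simp add: vector_space_def)
qed

lemma comm_algebra_gscale: "comm_algebra gscale"
  by (simp add: comm_algebra_def vector_space_gscale) (simp add: gscale_def mult.assoc)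

lemma derivation_gD: "derivation gscale (gD :: 'f::field_char_0 curve_ring \<Rightarrow> _)"
  unfolding derivation_def Vector_Spaces.linear_iff
proof (intro conjI allI vector_space_gscale)
  note d = derivation_simps[OF derivation_pD]
  fix u v :: "'f curve_ring" and c :: 'f
  obtain p q where [simp]: "u = proj p" "v = proj q"
    by (metis curve_ring_cases)
  show "gD (u + v) = gD u + gD v"
    by (simp add: gD_proj d flip: proj_arith)
  show "gD (u * v) = gD u * v + u * gD v"
    by (simp add: gD_proj d flip: proj_arith)
  show "gD (gscale c u) = gscale c (gD u)"
    by (simp add: gD_proj d flip: proj_pscale)
qed

interpretation G: vector_space gscale
  by (rule vector_space_gscale)

lemmas gD_simps = derivation_simps[OF derivation_gD]

lemma gscale_mult: "gscale c a * b = gscale c (a * b)" "b * gscale c a = gscale c (b * a)"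
  by (simp_all add: gscale_def mult_ac)

lemma gscale_of_nat: "gscale (of_nat n) z = of_nat n * z"
  by (induction n) (simp_all add: G.scale_left_distrib algebra_simps)

lemma gscale_numeral: "gscale (numeral n) z = numeral n * z"
  using gscale_of_nat[of "numeral n" z] by simp

lemma subspace_cancel_of_nat:
  assumes "G.subspace (I :: 'f::field_char_0 curve_ring set)" "of_nat n * z \<in> I" "n > 0"
  shows "z \<in> I"
proof -
  have "gscale (inverse (of_nat n)) (gscale (of_nat n) z) \<in> I"
    using assms unfolding gscale_of_nat by (intro G.subspace_scale)
  then show ?thesis using assms by simp
qed

section \<open>The algebra \<open>A\<close> and the module \<open>M\<close> in coordinates\<close>

text \<open>
  \<open>A\<close> and \<open>M\<close> are free over \<open>F[y\<^sup>2]\<close> with bases \<open>1, xy\<close> and \<open>y, x\<close>. The basic elements get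
  names of their own so that the multiplication table of these bases can serve as a rewrite system.
\<close>

definition gT :: "'f::field_char_0 curve_ring" where "gT = gY\<^sup>2"

definition gS :: "'f::field_char_0 curve_ring" where "gS = gX * gY"

lemma gXY_mult:
  shows "gX * gX = 1 - gT * (gT :: 'f::field_char_0 curve_ring)" "gY * gY = (gT :: 'f curve_ring)"
    "gX * gY = (gS :: 'f curve_ring)" "gY * gX = (gS :: 'f curve_ring)"
    "gX * gS = gY * (1 - gT * (gT :: 'f curve_ring))" "gY * gS = gX * (gT :: 'f curve_ring)"
    "gS * gS = gT - (gT :: 'f curve_ring) ^ 3"
proof -
  have "proj (curve_poly :: 'f poly poly) = proj 0"
    by (simp add: proj_eq_iff)
  then have "(gX :: 'f curve_ring)\<^sup>2 + gY ^ 4 - 1 = 0"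
    by (simp add: curve_poly_def proj_arith proj_power gX_def gY_def)
  then show X: "gX * gX = 1 - gT * (gT :: 'f curve_ring)"
    by (simp add: gT_def power2_eq_square power4_eq_xxxx mult.assoc eq_diff_eq)
  show Y: "gY * gY = (gT :: 'f curve_ring)" and "gX * gY = (gS :: 'f curve_ring)"
    and "gY * gX = (gS :: 'f curve_ring)"
    by (simp_all add: gT_def gS_def power2_eq_square mult.commute)
  have "gX * gS = (gX * gX) * (gY :: 'f curve_ring)" "gY * gS = gX * (gY * gY :: 'f curve_ring)"
    "gS * gS = (gX * gX) * (gY * gY :: 'f curve_ring)"
    by (simp_all add: gS_def mult_ac)
  then show "gX * gS = gY * (1 - gT * (gT :: 'f curve_ring))" "gY * gS = gX * (gT :: 'f curve_ring)"
    "gS * gS = gT - (gT :: 'f curve_ring) ^ 3"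
    unfolding X Y by (simp_all add: algebra_simps power3_eq_cube)
qed

lemma gD_XYTS:
  shows "gD gX = 2 * (gT * (gY :: 'f::field_char_0 curve_ring))"
    "gD gY = - (gX :: 'f curve_ring)" "gD gT = - 2 * (gS :: 'f curve_ring)"
    "gD gS = 3 * (gT * gT) - (1 :: 'f curve_ring)" "gD (1 :: 'f curve_ring) = 0"
proof -
  have two: "proj (2 :: 'f poly poly) = 2"
    by (metis one_add_one proj_arith(1,5))
  show X: "gD gX = 2 * (gT * (gY :: 'f curve_ring))"
    by (simp add: gX_def gD_proj pD_pX proj_arith proj_power two)
      (simp add: gT_def gY_def power3_eq_cube power2_eq_square)
  show Y: "gD gY = - (gX :: 'f curve_ring)"
    by (simp add: gX_def gY_def gD_proj pD_pY proj_arith)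
  show "gD gT = - 2 * (gS :: 'f curve_ring)"
    by (simp add: gT_def gS_def power2_eq_square gD_simps Y)
  have "gD gS = 2 * gT * (gY * gY) - gX * (gX :: 'f curve_ring)"
    by (simp add: gS_def gD_simps X Y algebra_simps)
  then show "gD gS = 3 * (gT * gT) - (1 :: 'f curve_ring)"
    by (simp add: gXY_mult)
  show "gD (1 :: 'f curve_ring) = 0"
    by (simp add: gD_proj pD_1 flip: proj_arith)
qed

definition at_ysq :: "'f::field_char_0 poly \<Rightarrow> 'f curve_ring" where
  "at_ysq p = poly (map_poly (\<lambda>c. gscale c 1) p) gT"

lemma at_ysq_pCons [simp]: "at_ysq (pCons c p) = gscale c 1 + gT * at_ysq p"
  by (simp add: at_ysq_def map_poly_pCons)

lemma at_ysq_0 [simp]: "at_ysq 0 = 0"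
  by (simp add: at_ysq_def)

lemma at_ysq_1 [simp]: "at_ysq 1 = 1"
  by (simp add: one_pCons)

lemma at_ysq_add: "at_ysq (p + q) = at_ysq p + at_ysq q"
  by (induction p q rule: poly_induct2) (simp_all add: G.scale_left_distrib algebra_simps)

lemma at_ysq_smult: "at_ysq (smult c p) = gscale c (at_ysq p)"
  by (induction p) (simp_all add: G.scale_right_distrib gscale_mult)

lemma at_ysq_minus: "at_ysq (- p) = - at_ysq p"
  using at_ysq_smult[of "-1" p] by simp

lemma at_ysq_diff: "at_ysq (p - q) = at_ysq p - at_ysq q"
  using at_ysq_add[of p "- q"] by (simp add: at_ysq_minus)

lemma at_ysq_mult: "at_ysq (p * q) = at_ysq p * at_ysq q"
  by (induction p) (simp_all add: at_ysq_add at_ysq_smult gscale_mult algebra_simps)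

lemma at_ysq_t [simp]: "at_ysq [:0, 1:] = gT"
  by simp

lemmas at_ysq_hom = at_ysq_add at_ysq_diff at_ysq_minus at_ysq_mult at_ysq_smult

lemma gD_at_ysq: "gD (at_ysq p) = - 2 * gS * at_ysq (pderiv p)"
  by (induction p)
    (simp_all add: gD_simps gD_XYTS pderiv_pCons at_ysq_add algebra_simps)

text \<open>
  A nonzero multiple of \<open>x\<^sup>2 + y\<^sup>4 - 1\<close> still involves \<open>x\<close> after any substitution of a scalar
  for \<open>y\<close> that does not annihilate it, so a polynomial in \<open>y\<^sup>2\<close> alone is a multiple only if it
  vanishes at all squares of scalars.
\<close>

lemma at_ysq_eq_0_iff: "at_ysq p = 0 \<longleftrightarrow> p = (0 :: 'f::field_char_0 poly)"
proof
  assume "at_ysq p = 0"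
  have "\<exists>P. at_ysq p = proj P \<and> (\<forall>b. poly P [:b:] = [:poly p (b\<^sup>2):])"
  proof (induction p)
    case 0
    show ?case by (rule exI[of _ 0]) (simp add: proj_arith)
  next
    case (pCons c p)
    then obtain P where P: "at_ysq p = proj P" "\<And>b. poly P [:b:] = [:poly p (b\<^sup>2):]"
      by blast
    have "at_ysq (pCons c p) = proj ([:[:c:]:] + pY\<^sup>2 * P)"
      by (simp add: P proj_arith proj_power gT_def gY_def gscale_def)
    moreover have "\<forall>b. poly ([:[:c:]:] + pY\<^sup>2 * P) [:b:] = [:poly (pCons c p) (b\<^sup>2):]"
      by (simp add: P pY_def power2_eq_square)
    ultimately show ?case by blast
  qed
  then obtain P where P: "at_ysq p = proj P" "\<And>b. poly P [:b:] = [:poly p (b\<^sup>2):]"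
    by blast
  then have "proj P = proj 0"
    using \<open>at_ysq p = 0\<close> by (simp add: proj_arith)
  then obtain Q where Q: "P = curve_poly * Q"
    by (auto simp: proj_eq_iff elim: dvdE)
  have root: "poly p (b\<^sup>2) = 0" for b
  proof (rule ccontr)
    assume nz: "poly p (b\<^sup>2) \<noteq> 0"
    have curve: "poly curve_poly [:b:] = [:b ^ 4 - 1, 0, 1:]"
      by (simp add: curve_poly_def pX_def pY_def power2_eq_square power4_eq_xxxx one_pCons)
    have eq: "[:poly p (b\<^sup>2):] = [:b ^ 4 - 1, 0, 1:] * poly Q [:b:]"
      using P(2)[of b] by (simp only: Q poly_mult curve)
    then have "poly Q [:b:] \<noteq> 0"
      using nz by auto
    then have "degree ([:b ^ 4 - 1, 0, 1:] * poly Q [:b:]) \<ge> 2"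
      by (subst degree_mult_eq) auto
    then show False
      unfolding eq[symmetric] by simp
  qed
  show "p = 0"
  proof (rule ccontr)
    assume "p \<noteq> 0"
    have "range (\<lambda>n. (of_nat (n\<^sup>2) :: 'f)) \<subseteq> {z. poly p z = 0}"
      using root[of "of_nat _"] by auto
    moreover have "inj (\<lambda>n. (of_nat (n\<^sup>2) :: 'f))"
      by (rule injI) (simp only: of_nat_eq_iff power2_eq_iff_nonneg zero_le)
    ultimately show False
      using poly_roots_finite[OF \<open>p \<noteq> 0\<close>] finite_subset range_inj_infinite by blast
  qed
qed simp

text \<open>
  Multiplication by \<open>y u - x v\<close> turns a relation \<open>y u + x v = 0\<close> into \<open>t u\<^sup>2 = (1 - t\<^sup>2) v\<^sup>2\<close>,
  an identity in \<open>F[t]\<close> that the parity of degrees excludes unless \<open>u = v = 0\<close>.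
\<close>

lemma XY_independent:
  assumes "gY * at_ysq u + gX * at_ysq v = 0"
  shows "u = 0 \<and> v = 0"
proof -
  have "at_ysq ([:0, 1:] * u\<^sup>2 - [:1, 0, -1:] * v\<^sup>2)
      = (gY * gY) * (at_ysq u * at_ysq u) - (gX * gX) * (at_ysq v * at_ysq v)"
    by (simp add: at_ysq_hom power2_eq_square gXY_mult algebra_simps del: mult_pCons_left)
  also have "\<dots> = (gY * at_ysq u + gX * at_ysq v) * (gY * at_ysq u - gX * at_ysq v)"
    by (simp add: algebra_simps)
  finally have "[:0, 1:] * u\<^sup>2 = [:1, 0, -1:] * v\<^sup>2"
    using assms by (simp add: at_ysq_eq_0_iff del: mult_pCons_left)
  then show ?thesis
    by (subst (asm) degree_diff_weighted_squares(2)) auto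
qed

lemma algA_eq: "algA = {at_ysq p + gS * at_ysq q | p q. True}" (is "_ = ?B")
proof
  have B_mult: "(at_ysq p + gS * at_ysq q) * (at_ysq p' + gS * at_ysq q')
      = at_ysq (p * p' + [:0, 1, 0, -1:] * (q * q')) + gS * at_ysq (p * q' + q * p')"
    for p q p' q' :: "'a poly"
  proof -
    have "at_ysq [:0, 1, 0, -1:] = gS * (gS :: 'a curve_ring)"
      by (simp add: gXY_mult algebra_simps power3_eq_cube)
    then show ?thesis
      by (simp only: at_ysq_hom) (simp add: algebra_simps)
  qed
  have "G.subspace ?B"
    unfolding G.subspace_def
  proof (intro conjI ballI allI)
    have "0 = at_ysq 0 + gS * at_ysq 0" by simp
    then show "0 \<in> ?B" by blast
  next
    fix u v assume "u \<in> ?B" "v \<in> ?B"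
    then obtain p q p' q' where "u = at_ysq p + gS * at_ysq q" "v = at_ysq p' + gS * at_ysq q'"
      by blast
    then have "u + v = at_ysq (p + p') + gS * at_ysq (q + q')"
      by (simp add: at_ysq_hom algebra_simps)
    then show "u + v \<in> ?B" by blast
  next
    fix c u assume "u \<in> ?B"
    then obtain p q where "u = at_ysq p + gS * at_ysq q"
      by blast
    then have "gscale c u = at_ysq (smult c p) + gS * at_ysq (smult c q)"
      by (simp add: at_ysq_hom gscale_mult G.scale_right_distrib)
    then show "gscale c u \<in> ?B" by blast
  qed
  moreover have "u * v \<in> ?B" if "u \<in> ?B" "v \<in> ?B" for u v
    using that B_mult by blast
  moreover have "1 = at_ysq 1 + gS * at_ysq 0" "gY\<^sup>2 = at_ysq [:0, 1:] + gS * at_ysq 0"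
    "gX * gY = at_ysq 0 + gS * at_ysq 1"
    by (simp_all add: gT_def gS_def)
  then have "{1, gY\<^sup>2, gX * gY} \<subseteq> ?B" by blast
  ultimately show "algA \<subseteq> ?B"
    unfolding algA_def generated_subalgebra_def subalgebra_def by (intro Inter_lower) blast
  show "?B \<subseteq> algA"
    unfolding algA_def generated_subalgebra_def
  proof (rule Inter_greatest)
    fix C :: "'a curve_ring set"
    assume "C \<in> {B. subalgebra gscale B \<and> {1, gY\<^sup>2, gX * gY} \<subseteq> B}"
    then have C: "G.subspace C" "\<And>a b. a \<in> C \<Longrightarrow> b \<in> C \<Longrightarrow> a * b \<in> C" "1 \<in> C" "gT \<in> C" "gS \<in> C"
      by (auto simp: subalgebra_def gT_def gS_def)
    have "at_ysq p \<in> C" for p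
      by (induction p)
        (simp_all add: C G.subspace_0 G.subspace_add G.subspace_scale)
    then show "?B \<subseteq> C"
      using C(2)[OF C(5)] G.subspace_add[OF C(1)] by blast
  qed
qed

lemma subalgebra_algA: "subalgebra gscale algA"
  unfolding algA_def generated_subalgebra_def subalgebra_def
  by (auto intro!: G.subspace_Inter)

lemma algA_closed:
  "a \<in> algA \<Longrightarrow> b \<in> algA \<Longrightarrow> a + b \<in> algA" "a \<in> algA \<Longrightarrow> b \<in> algA \<Longrightarrow> a - b \<in> algA"
  "a \<in> algA \<Longrightarrow> - a \<in> algA" "a \<in> algA \<Longrightarrow> b \<in> algA \<Longrightarrow> a * b \<in> algA" "a \<in> algA \<Longrightarrow> gscale c a \<in> algA"
proof -
  have A: "G.subspace (algA :: 'a curve_ring set)"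
    by (rule subalgebra_algA[unfolded subalgebra_def, THEN conjunct1])
  show "a \<in> algA \<Longrightarrow> b \<in> algA \<Longrightarrow> a + b \<in> algA" "a \<in> algA \<Longrightarrow> b \<in> algA \<Longrightarrow> a - b \<in> algA"
    "a \<in> algA \<Longrightarrow> - a \<in> algA" "a \<in> algA \<Longrightarrow> gscale c a \<in> algA"
    by (rule G.subspace_add[OF A] G.subspace_diff[OF A] G.subspace_neg[OF A]
        G.subspace_scale[OF A]; assumption)+
  show "a \<in> algA \<Longrightarrow> b \<in> algA \<Longrightarrow> a * b \<in> algA"
    by (rule subalgebra_algA[unfolded subalgebra_def, THEN conjunct2, rule_format])
qed

lemma at_ysq_algA: "at_ysq p \<in> algA"
proof -
  have "at_ysq p = at_ysq p + gS * at_ysq 0" by simp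
  then show ?thesis unfolding algA_eq by blast
qed

lemma algA_elements:
  shows "(0 :: 'f::field_char_0 curve_ring) \<in> algA" "(1 :: 'f curve_ring) \<in> algA"
    "(gT :: 'f curve_ring) \<in> algA" "(gS :: 'f curve_ring) \<in> algA"
    "(numeral n :: 'f curve_ring) \<in> algA"
proof -
  show "(0 :: 'f curve_ring) \<in> algA" and one: "(1 :: 'f curve_ring) \<in> algA"
    and "(gT :: 'f curve_ring) \<in> algA"
    using at_ysq_algA[of 0] at_ysq_algA[of 1] at_ysq_algA[of "[:0, 1:]"] by simp_all
  have "(gS :: 'f curve_ring) = at_ysq 0 + gS * at_ysq 1" by simp
  then show "(gS :: 'f curve_ring) \<in> algA" unfolding algA_eq by blast
  show "(numeral n :: 'f curve_ring) \<in> algA"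
    using algA_closed(5)[OF one, of "numeral n"] by (simp add: gscale_numeral)
qed

lemma gD_algA: "gD a \<in> algA" if "a \<in> algA"
proof -
  obtain p q where a: "a = at_ysq p + gS * at_ysq q"
    using \<open>a \<in> algA\<close> by (auto simp: algA_eq)
  show ?thesis
    unfolding a gD_simps gD_at_ysq gD_XYTS
    by (intro algA_closed at_ysq_algA algA_elements)
qed

lemma modM_closed:
  fixes m n a :: "'f::field_char_0 curve_ring"
  shows
  "m \<in> modM \<Longrightarrow> n \<in> modM \<Longrightarrow> m + n \<in> modM" "a \<in> algA \<Longrightarrow> m \<in> modM \<Longrightarrow> a * m \<in> modM"
  "m \<in> modM \<Longrightarrow> gD m \<in> modM" "m \<in> modM \<Longrightarrow> n \<in> modM \<Longrightarrow> m * n \<in> algA"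
  "gX \<in> (modM :: 'f curve_ring set)" "gY \<in> (modM :: 'f curve_ring set)"
  "0 \<in> (modM :: 'f curve_ring set)"
proof -
  have I: "m \<in> modM" if "m = gX * a + gY * b" "a \<in> algA" "b \<in> algA" for m a b :: "'f curve_ring"
    using that by (auto simp: modM_def)
  show "gX \<in> (modM :: 'f curve_ring set)" "gY \<in> (modM :: 'f curve_ring set)"
    "0 \<in> (modM :: 'f curve_ring set)"
    by (rule I[of _ 1 0] I[of _ 0 1] I[of _ 0 0]; simp add: algA_elements)+
  show "a * m \<in> modM" if "a \<in> algA" "m \<in> modM"
  proof -
    obtain b c where m: "m = gX * b + gY * c" "b \<in> algA" "c \<in> algA"
      using \<open>m \<in> modM\<close> by (auto simp: modM_def)
    show ?thesis
      by (rule I[of _ "a * b" "a * c"]) (use m that in \<open>simp_all add: algA_closed algebra_simps\<close>)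
  qed
  show "gD m \<in> modM" if "m \<in> modM"
  proof -
    obtain b c where m: "m = gX * b + gY * c" "b \<in> algA" "c \<in> algA"
      using \<open>m \<in> modM\<close> by (auto simp: modM_def)
    have "gD m = gX * (gD b - c) + gY * (gD c + 2 * gT * b)"
      by (simp add: m gD_simps gD_XYTS algebra_simps)
    then show ?thesis
      by (rule I) (intro algA_closed gD_algA algA_elements m)+
  qed
  assume "m \<in> modM" "n \<in> modM"
  then obtain b c b' c' where m: "m = gX * b + gY * c" "b \<in> algA" "c \<in> algA"
    and n: "n = gX * b' + gY * c'" "b' \<in> algA" "c' \<in> algA"
    by (auto simp: modM_def)
  show "m + n \<in> modM"
    by (rule I[of _ "b + b'" "c + c'"]) (use m n in \<open>simp_all add: algA_closed algebra_simps\<close>)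
  have "m * n = (gX * gX) * (b * b') + (gX * gY) * (b * c' + c * b') + (gY * gY) * (c * c')"
    by (simp add: m n algebra_simps)
  also have "\<dots> \<in> algA"
    unfolding gXY_mult by (intro algA_closed algA_elements m n)
  finally show "m * n \<in> algA" .
qed

lemma modM_coordinates:
  assumes "m \<in> modM"
  obtains p q where "m = gY * at_ysq p + gX * at_ysq q"
proof -
  obtain a b a' b' where m: "m = gX * (at_ysq a + gS * at_ysq b) + gY * (at_ysq a' + gS * at_ysq b')"
    using assms unfolding modM_def algA_eq by blast
  have "at_ysq [:1, 0, -1:] = 1 - gT * (gT :: 'a curve_ring)"
    by (simp add: algebra_simps)
  then have "m = gY * at_ysq (a' + [:1, 0, -1:] * b) + gX * at_ysq (a + [:0, 1:] * b')"
    unfolding m by (simp only: at_ysq_hom distrib_left mult.assoc[symmetric] gXY_mult at_ysq_t)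
      (simp add: algebra_simps)
  then show ?thesis by (rule that)
qed

global_interpretation JA: vector_type_pair gscale gD algA modM
  rewrites "vector_superalg_on gscale gD algA modM = JA"
proof -
  show "vector_type_pair gscale gD (algA :: 'a curve_ring set) modM"
  proof
    show "G.subspace (modM :: 'a curve_ring set)"
      unfolding G.subspace_def
    proof (intro conjI ballI allI modM_closed(1,7))
      fix c and m :: "'a curve_ring" assume m: "m \<in> modM"
      then have "gscale c 1 * m \<in> modM"
        by (intro modM_closed algA_closed algA_elements)
      then show "gscale c m \<in> modM" by (simp add: gscale_mult)
    qed assumption+
    show "gD m * n - m * gD n \<in> algA" if "m \<in> modM" "n \<in> modM" for m n :: "'a curve_ring"
      using that by (intro algA_closed(2) modM_closed(3,4))
  qed (simp_all add: comm_algebra_gscale derivation_gD subalgebra_algA algA_elements modM_closed)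
qed (simp add: JA_def)

section \<open>Simplicity\<close>

lemma derivation_power:
  fixes d :: "'g::comm_ring_1 \<Rightarrow> 'g"
  assumes "derivation s d"
  shows "d (a ^ Suc n) = of_nat (Suc n) * (a ^ n * d a)"
  by (induction n) (simp_all add: derivation_simps[OF assms] algebra_simps)

text \<open>
  A Bezout identity for \<open>s\<^sup>2 = t - t\<^sup>3\<close> and \<open>D(s) = 3t\<^sup>2 - 1\<close>, the latter being minus the derivative
  of \<open>t - t\<^sup>3\<close>: it expresses that \<open>t - t\<^sup>3\<close> has no multiple roots.
\<close>

lemma dS_T_comaximal: "9 * gT * gS * gS - (2 - 3 * (gT * gT)) * gD gS = 2"
proof -
  have "9 * gT * gS * gS = 9 * gT * (gS * gS)"
    by (simp add: mult.assoc)
  then show ?thesis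
    by (simp only: gXY_mult gD_XYTS) (simp add: algebra_simps power3_eq_cube)
qed

context
  fixes I :: "'f::field_char_0 curve_ring set"
  assumes I_subspace: "G.subspace I"
    and I_algA: "\<And>a b. a \<in> algA \<Longrightarrow> b \<in> I \<Longrightarrow> a * b \<in> I"
    and I_gD: "\<And>b. b \<in> I \<Longrightarrow> gD b \<in> I"
begin

text \<open>
  Besides \<open>s\<^sup>k\<^sup>+\<^sup>1\<close>, the ideal contains \<open>s\<^sup>k D(s)\<close>, up to a nonzero integer factor the
  derivative of \<open>s\<^sup>k\<^sup>+\<^sup>1\<close>. The Bezout identity combines the two to \<open>2 s\<^sup>k\<close>.
\<close>

lemma power_gS_descend: "gS ^ k \<in> I \<Longrightarrow> 1 \<in> I"
proof (induction k)
  case (Suc k)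
  have "of_nat (Suc k) * (gS ^ k * gD gS) \<in> I"
    using I_gD[OF Suc.prems] by (simp add: derivation_power[OF derivation_gD] del: of_nat_Suc power_Suc)
  then have *: "gS ^ k * gD gS \<in> I"
    using subspace_cancel_of_nat[OF I_subspace] by blast
  have "(9 * gT * gS) * gS ^ Suc k - (2 - 3 * (gT * gT)) * (gS ^ k * gD gS) \<in> I"
    by (intro G.subspace_diff[OF I_subspace] I_algA[OF _ Suc.prems] I_algA[OF _ *]
        algA_closed algA_elements)
  also have "(9 * gT * gS) * gS ^ Suc k - (2 - 3 * (gT * gT)) * (gS ^ k * gD gS)
      = gS ^ k * (9 * gT * gS * gS - (2 - 3 * (gT * gT)) * gD gS)"
    by (simp add: algebra_simps)
  also have "\<dots> = of_nat 2 * gS ^ k"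
    unfolding dS_T_comaximal by simp
  finally have "gS ^ k \<in> I"
    using subspace_cancel_of_nat[OF I_subspace] by (meson zero_less_numeral)
  then show ?case by (rule Suc.IH)
qed simp

text \<open>
  With \<open>z = s\<^sup>k p(t)\<close>, the rule \<open>D(t) = -2s\<close> gives
  \<open>s D(z) = k D(s) z - 2 s\<^sup>k\<^sup>+\<^sup>2 p'(t)\<close>. So \<open>p\<close> can be differentiated inside the ideal until it is
  constant, which leaves a power of \<open>s\<close>.
\<close>

lemma poly_ysq_descend:
  assumes "gS ^ k * at_ysq p \<in> I" "p \<noteq> 0"
  shows "1 \<in> I"
  using assms
proof (induction "degree p" arbitrary: p k)
  case 0
  then obtain c where p: "p = [:c:]" "c \<noteq> 0"
    by (metis degree_eq_zeroE pCons_0_0)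
  then have "gscale c (gS ^ k) \<in> I"
    using 0 by (simp add: gscale_mult)
  from G.subspace_scale[OF I_subspace this, of "inverse c"] have "gS ^ k \<in> I"
    using p by simp
  then show ?case
    by (rule power_gS_descend)
next
  case (Suc n)
  let ?z = "gS ^ k * at_ysq p"
  have dS: "gS * gD (gS ^ k) = of_nat k * (gS ^ k * gD gS)"
    by (cases k) (simp_all add: gD_XYTS(5) derivation_power[OF derivation_gD] mult_ac
        del: of_nat_Suc power_Suc, simp add: mult_ac)
  have k: "(of_nat k :: 'f curve_ring) \<in> algA"
    using algA_closed(5)[OF algA_elements(2), of "of_nat k"] by (simp add: gscale_of_nat)
  have "of_nat k * gD gS * ?z - gS * gD ?z \<in> I"
    by (intro G.subspace_diff[OF I_subspace] I_algA[OF _ Suc.prems(1)]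
        I_algA[OF _ I_gD[OF Suc.prems(1)]] algA_closed gD_algA algA_elements k)
  also have "gS * gD ?z = (gS * gD (gS ^ k)) * at_ysq p - 2 * (gS ^ Suc (Suc k) * at_ysq (pderiv p))"
    by (simp add: gD_simps gD_at_ysq algebra_simps)
  also have "of_nat k * gD gS * ?z - \<dots> = of_nat 2 * (gS ^ Suc (Suc k) * at_ysq (pderiv p))"
    unfolding dS by (simp add: algebra_simps)
  finally have "gS ^ Suc (Suc k) * at_ysq (pderiv p) \<in> I"
    using subspace_cancel_of_nat[OF I_subspace] by (meson zero_less_numeral)
  then show ?case
    using Suc.hyps(2)
    by (intro Suc.hyps(1)[of "pderiv p" "Suc (Suc k)"]) (simp_all add: degree_pderiv pderiv_eq_0_iff)
qed

text \<open>
  The norm \<open>p\<^sup>2 - (t - t\<^sup>3) q\<^sup>2\<close> of a nonzero \<open>p(t) + s q(t)\<close> is a nonzero polynomial in \<open>t\<close> that lies in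
  every ideal containing that element.
\<close>

lemma algA_gD_simple:
  assumes "I \<subseteq> algA" "I \<noteq> {0}"
  shows "1 \<in> I"
proof -
  obtain z where z: "z \<in> I" "z \<noteq> 0"
    using assms G.subspace_0[OF I_subspace] by blast
  then have "z \<in> algA"
    using assms by blast
  then obtain p q where pq: "z = at_ysq p + gS * at_ysq q"
    by (auto simp: algA_eq)
  have "(at_ysq p - gS * at_ysq q) * z \<in> I"
    by (intro I_algA z algA_closed at_ysq_algA algA_elements)
  also have "(at_ysq p - gS * at_ysq q) * z = at_ysq p * at_ysq p - (gS * gS) * (at_ysq q * at_ysq q)"
    by (simp add: pq algebra_simps)
  also have "\<dots> = at_ysq (1 * p\<^sup>2 - [:0, 1, 0, -1:] * q\<^sup>2)"
  proof -
    have "at_ysq [:0, 1, 0, -1:] = gS * (gS :: 'f curve_ring)"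
      by (simp add: gXY_mult algebra_simps power3_eq_cube)
    then show ?thesis
      by (simp only: at_ysq_hom power2_eq_square at_ysq_1 mult_1_left)
  qed
  finally have "gS ^ 0 * at_ysq (1 * p\<^sup>2 - [:0, 1, 0, -1:] * q\<^sup>2) \<in> I"
    by simp
  moreover have "1 * p\<^sup>2 \<noteq> [:0, 1, 0, -1:] * q\<^sup>2"
    using z pq by (subst degree_diff_weighted_squares(2)) auto
  ultimately show ?thesis
    using poly_ysq_descend[of 0 "1 * p\<^sup>2 - [:0, 1, 0, -1:] * q\<^sup>2"] by simp
qed

end

lemma simple_JA: "simple_superalgebra (JA :: ('f::field_char_0, _) superalg)"
proof (rule JA.simple_J)
  let ?MM = "{m * n | m n :: 'f curve_ring. m \<in> modM \<and> n \<in> modM}"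
  \<comment> \<open>The curve equation itself: \<open>x x + y (y\<^sup>2 y) = 1\<close>.\<close>
  have "gX * gX \<in> ?MM" "gY * (gT * gY) \<in> ?MM"
    using modM_closed(2)[OF algA_elements(3) modM_closed(6)] modM_closed(5,6) by blast+
  then have "gX * gX + gY * (gT * gY) \<in> G.span ?MM"
    by (intro G.span_add G.span_base)
  also have "gX * gX + gY * (gT * gY) = gX * gX + (gY * gY) * gT"
    by (simp add: mult_ac)
  also have "\<dots> = 1"
    unfolding gXY_mult by simp
  finally show "1 \<in> G.span ?MM" .
next
  let ?AdA = "{a * gD b | a b :: 'f curve_ring. a \<in> algA \<and> b \<in> algA}"
  \<comment> \<open>Twice the Bezout identity, with one factor \<open>s\<close> read as \<open>- D(t) / 2\<close>.\<close>
  have "- 9 * gT * gS \<in> (algA :: 'f curve_ring set)" "2 * (2 - 3 * (gT * gT)) \<in> (algA :: 'f curve_ring set)"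
    by (intro algA_closed algA_elements)+
  then have "(- 9 * gT * gS) * gD gT \<in> ?AdA" "(2 * (2 - 3 * (gT * gT))) * gD gS \<in> ?AdA"
    using algA_elements(3,4) by blast+
  then have "(- 9 * gT * gS) * gD gT - (2 * (2 - 3 * (gT * gT))) * gD gS \<in> G.span ?AdA"
    by (intro G.span_diff G.span_base)
  also have "(- 9 * gT * gS) * gD gT - (2 * (2 - 3 * (gT * gT))) * gD gS
      = 2 * (9 * gT * gS * gS - (2 - 3 * (gT * gT)) * gD gS)"
    unfolding gD_XYTS(3) by (simp add: algebra_simps)
  also have "\<dots> = of_nat 4 * 1"
    unfolding dS_T_comaximal by simp
  finally show "1 \<in> G.span ?AdA"
    using subspace_cancel_of_nat[OF G.subspace_span] by (meson zero_less_numeral)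
qed (auto intro: algA_gD_simple gD_algA)

section \<open>The odd part is not cyclic\<close>

text \<open>
  Since \<open>y p(t) + x q(t)\<close> has conjugate \<open>y p(t) - x q(t)\<close> under \<open>x \<mapsto> -x\<close>, its norm is
  \<open>t p\<^sup>2 - (1 - t\<^sup>2) q\<^sup>2\<close>, and norms are multiplicative. The norm of a generator divides \<open>t\<close>, so it has
  degree at most \<open>1\<close>; this forces \<open>q = 0\<close> by parity, and then \<open>t\<close> divides the norm of the
  generator, hence the norm \<open>t\<^sup>2 - 1\<close> of \<open>x\<close>, which is absurd.
\<close>

lemma modM_not_cyclic: "\<not> (\<exists>m\<in>modM. modM \<subseteq> {a * m | a. a \<in> (algA :: 'f::field_char_0 curve_ring set)})"
proof
  assume "\<exists>m\<in>modM. modM \<subseteq> {a * m | a. a \<in> (algA :: 'f curve_ring set)}"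
  then obtain m :: "'f curve_ring" where m: "m \<in> modM" "modM \<subseteq> {a * m | a. a \<in> algA}"
    by blast
  obtain p q where pq: "m = gY * at_ysq p + gX * at_ysq q"
    using modM_coordinates[OF m(1)] .
  let ?t = "[:0, 1:] :: 'f poly" and ?w = "[:1, 0, -1:] :: 'f poly"
  define n where "n = ?t * p\<^sup>2 - ?w * q\<^sup>2"
  have norm: "n dvd ?t * u\<^sup>2 - ?w * v\<^sup>2" if in_M: "gY * at_ysq u + gX * at_ysq v \<in> modM" for u v
  proof -
    obtain b c where bc: "gY * at_ysq u + gX * at_ysq v = (at_ysq b + gS * at_ysq c) * m"
      using subsetD[OF m(2) in_M] unfolding algA_eq by blast
    have w: "at_ysq ?w = 1 - gT * gT"
      by (simp add: algebra_simps)
    have "(at_ysq b + gS * at_ysq c) * m = gY * (at_ysq b * at_ysq p) + gX * (at_ysq b * at_ysq q)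
        + (gY * gS) * (at_ysq c * at_ysq p) + (gX * gS) * (at_ysq c * at_ysq q)"
      by (simp add: pq algebra_simps)
    also have "\<dots> = gY * at_ysq (b * p + ?w * (c * q)) + gX * at_ysq (b * q + ?t * (c * p))"
      by (simp only: at_ysq_hom at_ysq_t w gXY_mult) (simp add: algebra_simps)
    finally have "gY * at_ysq (u - (b * p + ?w * (c * q))) + gX * at_ysq (v - (b * q + ?t * (c * p))) = 0"
      unfolding bc[symmetric] by (simp only: at_ysq_diff) (simp add: algebra_simps)
    from XY_independent[OF this]
    have uv: "u = b * p + ?w * (c * q)" "v = b * q + ?t * (c * p)"
      by simp_all
    \<comment> \<open>The cofactor is the norm of \<open>b(t) + s c(t)\<close>.\<close>
    have "?t * u\<^sup>2 - ?w * v\<^sup>2 = n * (b\<^sup>2 - ?t * ?w * c\<^sup>2)"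
      unfolding uv n_def by algebra
    then show ?thesis by simp
  qed
  have n_t: "n dvd ?t" and n_w: "n dvd - ?w"
    using norm[of 1 0] norm[of 0 1] modM_closed(5,6) by simp_all
  have "degree n \<le> 1"
    using dvd_imp_degree_le[OF n_t] by simp
  moreover have "degree n \<ge> degree (?w * q\<^sup>2)"
    unfolding n_def by (subst degree_diff_weighted_squares(1)) auto
  moreover have "degree (?w * q\<^sup>2) \<ge> 2" if "q \<noteq> 0"
    using that by (subst degree_mult_eq) auto
  ultimately have "q = 0"
    by fastforce
  then have "?t dvd n"
    by (simp add: n_def del: mult_pCons_left)
  then have "?t dvd - ?w"
    using n_w by (rule dvd_trans)
  then obtain k where "- ?w = ?t * k"
    by (elim dvdE)
  then have "poly (- ?w) 0 = poly (?t * k) 0"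
    by (simp only:)
  then show False by simp
qed

theorem theorem1:
  shows
    "derivation pscale (pD :: 'f::field_char_0 poly poly \<Rightarrow> 'f poly poly)
     \<and> (\<forall>p :: 'f poly poly. gD (proj p) = proj (pD p))
     \<and> comm_algebra (gscale :: 'f \<Rightarrow> 'f curve_ring \<Rightarrow> 'f curve_ring)
     \<and> derivation gscale (gD :: 'f curve_ring \<Rightarrow> 'f curve_ring)
     \<and> (\<exists>z :: 'f curve_ring. gD z \<noteq> 0)
     \<and> subsuperalgebra (JA :: ('f, 'f curve_ring \<times> 'f curve_ring) superalg)
          (vector_superalg gscale gD)
     \<and> (\<forall>a \<in> (algA :: 'f curve_ring set). \<forall>b \<in> algA.
          mul JA (bar (gX * a)) (bar (gX * b)) = ev (D11 a * b - a * D11 b)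
          \<and> mul JA (bar (gY * a)) (bar (gY * b)) = ev (D22 a * b - a * D22 b)
          \<and> mul JA (bar (gX * a)) (bar (gY * b))
              = ev ((1 + gY ^ 4) * a * b + D12 a * b - a * D12 b))
     \<and> simple_superalgebra (JA :: ('f, 'f curve_ring \<times> 'f curve_ring) superalg)
     \<and> submodule_on (algA :: 'f curve_ring set) (\<lambda>a. mul JA (ev a)) (bar ` modM)
     \<and> \<not> cyclic_module_on (algA :: 'f curve_ring set) (\<lambda>a. mul JA (ev a)) (bar ` modM)
     \<and> (\<forall>(s0 :: 'f \<Rightarrow> 'g::comm_ring \<Rightarrow> 'g) (D0 :: 'g \<Rightarrow> 'g).
          comm_algebra s0 \<and> derivation s0 D0 \<and> (\<exists>z. D0 z \<noteq> 0)
          \<longrightarrow> \<not> isomorphic_superalgebras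
                 (JA :: ('f, 'f curve_ring \<times> 'f curve_ring) superalg)
                 (vector_superalg s0 D0))"
proof (intro conjI allI ballI impI)
  show "derivation pscale (pD :: 'f poly poly \<Rightarrow> _)" "derivation gscale (gD :: 'f curve_ring \<Rightarrow> _)"
    "comm_algebra (gscale :: 'f \<Rightarrow> _)"
    by (rule derivation_pD derivation_gD comm_algebra_gscale)+
  show "gD (proj p) = proj (pD p)" for p :: "'f poly poly"
    by (rule gD_proj)
  show "\<exists>z :: 'f curve_ring. gD z \<noteq> 0"
  proof (rule ccontr)
    assume "\<not> ?thesis"
    then have "gD gS = (0 :: 'f curve_ring)" "gD gT = (0 :: 'f curve_ring)" by blast+
    then have "at_ysq [:-1, 0, 3:] = (0 :: 'f curve_ring)"
      by (simp add: gD_XYTS algebra_simps gscale_numeral)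
    then show False by (simp add: at_ysq_eq_0_iff del: at_ysq_pCons)
  qed
  interpret T: vector_type_pair "gscale :: 'f \<Rightarrow> _" gD UNIV UNIV
    by unfold_locales
      (auto simp: comm_algebra_gscale derivation_gD subalgebra_def G.subspace_UNIV)
  show "subsuperalgebra (JA :: ('f, _) superalg) (vector_superalg gscale gD)"
    using JA.superalgebra_J T.superalgebra_J
    by (auto simp: subsuperalgebra_def vector_superalg_def JA.J_simps T.J_simps)
  show "submodule_on (algA :: 'f curve_ring set) (\<lambda>a. mul JA (ev a)) (bar ` modM)"
    by (rule JA.submodule_on_odd)
  show not_cyclic: "\<not> cyclic_module_on (algA :: 'f curve_ring set) (\<lambda>a. mul JA (ev a)) (bar ` modM)"
    unfolding JA.cyclic_odd_iff by (rule modM_not_cyclic)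
  show "simple_superalgebra (JA :: ('f, _) superalg)"
    by (rule simple_JA)
  show "\<not> isomorphic_superalgebras (JA :: ('f, _) superalg) (vector_superalg s0 D0)"
    if "comm_algebra s0 \<and> derivation s0 D0 \<and> (\<exists>z. D0 z \<noteq> 0)"
    for s0 :: "'f \<Rightarrow> 'g \<Rightarrow> 'g" and D0
    using that not_cyclic JA.iso_imp_cyclic_odd by blast
  fix a b :: "'f curve_ring"
  have pow4: "gY ^ 4 = gT * (gT :: 'f curve_ring)"
    by (simp add: gT_def power2_eq_square power4_eq_xxxx mult.assoc)
  show "mul JA (bar (gX * a)) (bar (gX * b)) = ev (D11 a * b - a * D11 b)"
  proof -
    have "gD (gX * a) * (gX * b) - gX * a * gD (gX * b) = (gX * gX) * (gD a * b - a * gD b)"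
      by (simp add: gD_simps algebra_simps)
    then show ?thesis
      by (simp add: JA.J_simps JA.mul_simps ev_bar_arith D11_def pow4 gXY_mult algebra_simps)
  qed
  show "mul JA (bar (gY * a)) (bar (gY * b)) = ev (D22 a * b - a * D22 b)"
  proof -
    have "gD (gY * a) * (gY * b) - gY * a * gD (gY * b) = (gY * gY) * (gD a * b - a * gD b)"
      by (simp add: gD_simps algebra_simps)
    then show ?thesis
      by (simp add: JA.J_simps JA.mul_simps ev_bar_arith D22_def gXY_mult algebra_simps
          flip: gT_def)
  qed
  show "mul JA (bar (gX * a)) (bar (gY * b))
      = ev ((1 + gY ^ 4) * a * b + D12 a * b - a * D12 b)"
  proof -
    have "gD (gX * a) * (gY * b) - gX * a * gD (gY * b)
        = (2 * gT * (gY * gY) + gX * gX) * (a * b) + (gX * gY) * (gD a * b - a * gD b)"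
      by (simp add: gD_simps gD_XYTS algebra_simps)
    then show ?thesis
      by (simp add: JA.J_simps JA.mul_simps ev_bar_arith D12_def pow4 gXY_mult algebra_simps)
  qed
qed

end
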